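(* Let $a,b>0$, $0\leq\nu\leq 1$ and $N\in\mathbb{N}$ (with $N\ge 1$). Then $$K\left(\sqrt[2^N]{\frac{b}{a}},2\right)^{\beta_N(\nu)}a^{\nu}b^{1-\nu}+S_N(\nu;a,b)\leq \nu a+(1-\nu)b.$$
   Context: $[x]$ denotes the greatest integer $\le x$. $K(t,2)=\frac{(t+1)^2}{4t}$ for $t>0$ (Kantorovich constant). $\alpha_N(\nu)=1+[2^{N}\nu]-2^{N}\nu$ and $\beta_N(\nu)=\min\{\alpha_N(\nu),1-\alpha_N(\nu)\}$. For $\nu\in[0,1]$ and $j\geq 1$ put $k_j(\nu)=[2^{j-1}\nu]$, $r_j(\nu)=[2^{j}\nu]$ and $s_j(\nu)=(-1)^{r_j(\nu)}2^{j-1}\nu+(-1)^{r_j(\nu)+1}\left[\frac{r_j(\nu)+1}{2}\right]$. For $a,b>0$, $\nu\in[0,1]$ and $N\ge 1$ define $$S_N(\nu;a,b)=\sum_{j=1}^{N}s_j(\nu)\left(\sqrt[2^j]{b^{2^{j-1}-k_j(\nu)}a^{k_j(\nu)}}-\sqrt[2^{j}]{a^{k_j(\nu)+1}b^{2^{j-1}-k_j(\nu)-1}}\right)^2 .$$ *)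

theory Defs
  imports Complex_Main
begin

text \<open>The Kantorovich constant \<open>K(t, 2)\<close>, for \<open>t > 0\<close>.\<close>

definition kantorovich :: "real \<Rightarrow> real" where
  "kantorovich t = (t + 1)\<^sup>2 / (4 * t)"

definition alpha :: "nat \<Rightarrow> real \<Rightarrow> real" where
  "alpha N \<nu> = 1 + of_int \<lfloor>2 ^ N * \<nu>\<rfloor> - 2 ^ N * \<nu>"

definition beta :: "nat \<Rightarrow> real \<Rightarrow> real" where
  "beta N \<nu> = min (alpha N \<nu>) (1 - alpha N \<nu>)"

text \<open>The index \<open>j\<close> ranges over \<open>j \<ge> 1\<close>, so the truncated subtraction \<open>j - 1\<close> is exact.\<close>

definition k_coeff :: "nat \<Rightarrow> real \<Rightarrow> int" where
  "k_coeff j \<nu> = \<lfloor>2 ^ (j - 1) * \<nu>\<rfloor>"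

definition r_coeff :: "nat \<Rightarrow> real \<Rightarrow> int" where
  "r_coeff j \<nu> = \<lfloor>2 ^ j * \<nu>\<rfloor>"

definition s_coeff :: "nat \<Rightarrow> real \<Rightarrow> real" where
  "s_coeff j \<nu> = (-1) powi (r_coeff j \<nu>) * 2 ^ (j - 1) * \<nu>
     + (-1) powi (r_coeff j \<nu> + 1) * of_int \<lfloor>(of_int (r_coeff j \<nu>) + 1) / (2 :: real)\<rfloor>"

text \<open>The exponents are integers, not naturals: for \<open>\<nu> = 1\<close> one has \<open>k_coeff j \<nu> = 2 ^ (j - 1)\<close>,
  and the last exponent of \<open>b\<close> is \<open>-1\<close>.\<close>

definition S_sum :: "nat \<Rightarrow> real \<Rightarrow> real \<Rightarrow> real \<Rightarrow> real" where
  "S_sum N \<nu> a b = (\<Sum>j = 1..N. s_coeff j \<nu> *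
     (root (2 ^ j) (b powi (2 ^ (j - 1) - k_coeff j \<nu>) * a powi (k_coeff j \<nu>))
      - root (2 ^ j) (a powi (k_coeff j \<nu> + 1) * b powi (2 ^ (j - 1) - k_coeff j \<nu> - 1)))\<^sup>2)"

end

theory Submission
  imports Defs "HOL-Analysis.Convex"
begin

text \<open>Let \<open>f t = a\<^sup>t b\<^bsup>1-t\<^esup>\<close>. The partial sum \<open>S\<^sub>N\<close> telescopes: the \<open>j\<close>-th term is the difference at
  \<open>\<nu>\<close> of the piecewise linear interpolants of \<open>f\<close> on the dyadic grids of mesh \<open>2\<^bsup>1-j\<^esup>\<close> and
  \<open>2\<^bsup>-j\<^esup>\<close>. Hence the right-hand side minus \<open>S\<^sub>N\<close> is the value at \<open>\<nu>\<close> of the interpolant of mesh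
  \<open>2\<^bsup>-N\<^esup>\<close>, a weighted arithmetic mean of two consecutive grid values of \<open>f\<close> whose weighted geometric
  mean is \<open>f \<nu>\<close>. The Kantorovich refinement of Young's inequality compares the two means.\<close>

text \<open>With \<open>w\<close> the arithmetic mean of \<open>x\<close> and \<open>y\<close>, the
  Kantorovich factor is \<open>w\<^sup>2 / (x * y)\<close>, and its power \<open>u\<close> cancels
  all of \<open>x\<close>: the left side becomes \<open>w powr (2 * u) * y powr (1 - 2 * u)\<close>.
  Young's inequality for \<open>w\<close> and \<open>y\<close> then gives the claim;
  \<open>u \<le> 1 / 2\<close> keeps the second weight nonnegative.\<close>

lemma kantorovich_young_aux:
  fixes x y u :: real
  assumes "x > 0" "y > 0" "0 \<le> u" "u \<le> 1 / 2"
  shows "((x + y)\<^sup>2 / (4 * x * y)) powr u * (x powr u * y powr (1 - u)) \<le> u * x + (1 - u) * y"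
proof -
  define z w where "z = (x + y)\<^sup>2 / (4 * x * y)" and "w = (x + y) / 2"
  have pos: "z > 0" "w > 0"
    using assms by (simp_all add: z_def w_def)
  have "z = w\<^sup>2 / (x * y)"
    by (simp add: z_def w_def power_divide)
  then have "ln z = 2 * ln w - ln x - ln y"
    using assms pos by (simp add: ln_div ln_mult ln_realpow)
  then have "z powr u * (x powr u * y powr (1 - u)) = w powr (2 * u) * y powr (1 - 2 * u)"
    using assms pos by (simp add: powr_def mult_exp_exp) (simp add: algebra_simps)
  also have "\<dots> \<le> 2 * u * w + (1 - 2 * u) * y"
    using assms pos by (intro Youngs_inequality_0) auto
  also have "\<dots> = u * x + (1 - u) * y"
    by (simp add: w_def field_simps)
  finally show ?thesis
    by (simp add: z_def)
qed

lemma kantorovich_young: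
  fixes x y u :: real
  assumes "x > 0" "y > 0" "0 \<le> u" "u \<le> 1"
  shows "kantorovich (x / y) powr min u (1 - u) * (x powr u * y powr (1 - u)) \<le> u * x + (1 - u) * y"
proof -
  have K: "kantorovich (x / y) = (x + y)\<^sup>2 / (4 * x * y)"
    using assms by (simp add: kantorovich_def power2_eq_square field_simps)
  show ?thesis
  proof (cases "u \<le> 1 / 2")
    case True
    then show ?thesis
      using kantorovich_young_aux[of x y u] assms by (simp add: K min_def)
  next
    case False
    then show ?thesis
      \<comment> \<open>The Kantorovich factor is symmetric in \<open>x\<close> and
        \<open>y\<close>, so both points and weights may be swapped.\<close>
      using kantorovich_young_aux[of y x "1 - u"] assms by (simp add: K min_def ac_simps)
  qed
qed

definition geom :: "real \<Rightarrow> real \<Rightarrow> real \<Rightarrow> real" where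
  "geom a b t = a powr t * b powr (1 - t)"

definition dyadic_interp :: "nat \<Rightarrow> (real \<Rightarrow> real) \<Rightarrow> real \<Rightarrow> real" where
  "dyadic_interp N f \<nu> =
     (1 - frac (2 ^ N * \<nu>)) * f (of_int \<lfloor>2 ^ N * \<nu>\<rfloor> / 2 ^ N)
     + frac (2 ^ N * \<nu>) * f ((of_int \<lfloor>2 ^ N * \<nu>\<rfloor> + 1) / 2 ^ N)"

lemma geom_pos [simp]: "a > 0 \<Longrightarrow> b > 0 \<Longrightarrow> geom a b t > 0"
  by (simp add: geom_def)

lemma geom_eq_exp: "a > 0 \<Longrightarrow> b > 0 \<Longrightarrow> geom a b t = exp (t * ln a + (1 - t) * ln b)"
  by (simp add: geom_def powr_def exp_add)

text \<open>The logarithm of \<open>geom a b\<close> is affine, so geometric means of its values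
  correspond to arithmetic means of the arguments.\<close>

lemma geom_powr_mult:
  assumes "a > 0" "b > 0"
  shows "geom a b s powr u * geom a b t powr (1 - u) = geom a b (u * s + (1 - u) * t)"
  using assms by (simp add: geom_eq_exp powr_def mult_exp_exp) (simp add: algebra_simps)

lemma geom_divide:
  assumes "a > 0" "b > 0"
  shows "geom a b s / geom a b t = (b / a) powr (t - s)"
  using assms by (simp add: geom_eq_exp powr_def ln_div flip: exp_diff) (simp add: algebra_simps)

text \<open>Turns the radicals of \<open>S_sum\<close> into square roots of grid values of
  \<open>geom\<close>. An integer \<open>m\<close> also covers \<open>m = 2 ^ n + 1\<close>, which
  occurs at \<nu> = 1 and gives \<open>b\<close> the exponent -1.\<close>

lemma root_powi_eq_sqrt_geom:
  fixes a b :: real and m :: int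
  assumes "a > 0" "b > 0"
  shows "root (2 ^ Suc n) (a powi m * b powi (2 ^ n - m)) = sqrt (geom a b (of_int m / 2 ^ n))"
proof -
  have "a powi m * b powi (2 ^ n - m) = geom a b (of_int m / 2 ^ n) ^ 2 ^ n"
  proof -
    have "b powi (2 ^ n - m) = b powr (2 ^ n - of_int m)"
      using assms powr_real_of_int'[of b "2 ^ n - m"] by simp
    moreover have "a powi m = a powr of_int m"
      using assms powr_real_of_int'[of a m] by simp
    ultimately show ?thesis
      using assms
      by (simp add: geom_def power_mult_distrib powr_power right_diff_distrib)
  qed
  then have "root (2 ^ n) (a powi m * b powi (2 ^ n - m)) = geom a b (of_int m / 2 ^ n)"
    using assms by (simp add: real_root_power_cancel less_imp_le)
  then show ?thesis
    by (simp add: real_root_mult_exp sqrt_def)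
qed

lemma geom_midpoint:
  assumes "a > 0" "b > 0"
  shows "sqrt (geom a b s) * sqrt (geom a b t) = geom a b ((s + t) / 2)"
  using geom_powr_mult[OF assms, of s "1 / 2" t] assms
  by (simp add: powr_half_sqrt less_imp_le add_divide_distrib)

lemma floor_frac_double:
  fixes x :: real
  shows "frac x < 1 / 2 \<Longrightarrow> \<lfloor>2 * x\<rfloor> = 2 * \<lfloor>x\<rfloor>"
    and "frac x \<ge> 1 / 2 \<Longrightarrow> \<lfloor>2 * x\<rfloor> = 2 * \<lfloor>x\<rfloor> + 1"
  using frac_lt_1[of x] by (auto simp: frac_def intro!: floor_unique)

text \<open>The parity of \<open>r_coeff\<close> tells in which half of its unit cell
  \<open>2 ^ n * \<nu>\<close> lies, so the alternating signs produce the distance to the nearest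
  integer.\<close>

lemma s_coeff_Suc:
  "s_coeff (Suc n) \<nu> = min (frac (2 ^ n * \<nu>)) (1 - frac (2 ^ n * \<nu>))"
proof -
  define x where "x = 2 ^ n * \<nu>"
  have s: "s_coeff (Suc n) \<nu> = (-1) powi \<lfloor>2 * x\<rfloor> * x
      + (-1) powi (\<lfloor>2 * x\<rfloor> + 1) * of_int \<lfloor>(of_int \<lfloor>2 * x\<rfloor> + 1) / (2 :: real)\<rfloor>"
    by (simp add: s_coeff_def r_coeff_def x_def mult.assoc)
  show ?thesis
  proof (cases "frac x < 1 / 2")
    case True
    then have "\<lfloor>2 * x\<rfloor> = 2 * \<lfloor>x\<rfloor>"
      by (rule floor_frac_double)
    moreover have "\<lfloor>(2 * of_int m + 1) / (2 :: real)\<rfloor> = m" for m :: int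
      by (rule floor_unique) auto
    ultimately have "s_coeff (Suc n) \<nu> = frac x"
      by (simp add: s power_int_add power_int_mult frac_def)
    then show ?thesis
      using True by (simp flip: x_def)
  next
    case False
    then have "\<lfloor>2 * x\<rfloor> = 2 * \<lfloor>x\<rfloor> + 1"
      by (intro floor_frac_double) simp
    moreover have "\<lfloor>(2 * of_int m + 1 + 1) / (2 :: real)\<rfloor> = m + 1" for m :: int
      by (rule floor_unique) auto
    ultimately have "s_coeff (Suc n) \<nu> = 1 - frac x"
      by (simp add: s power_int_add power_int_mult frac_def)
    then show ?thesis
      using False by (simp flip: x_def)
  qed
qed

text \<open>On a coarse cell with end values \<open>p\<close> and \<open>q\<close>, refinement
  lowers the midpoint value from \<open>(p + q) / 2\<close> to \<open>c = sqrt p * sqrt q\<close>, a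
  drop of \<open>(sqrt p - sqrt q)\<^sup>2 / 2\<close>. The difference of the interpolants is the
  tent of that height, vanishing at both ends; \<open>s_coeff\<close> is the tent of height
  1/2.\<close>

lemma dyadic_interp_step:
  assumes "a > 0" "b > 0"
  shows "dyadic_interp (Suc n) (geom a b) \<nu> + s_coeff (Suc n) \<nu> *
      (sqrt (geom a b (of_int \<lfloor>2 ^ n * \<nu>\<rfloor> / 2 ^ n))
       - sqrt (geom a b ((of_int \<lfloor>2 ^ n * \<nu>\<rfloor> + 1) / 2 ^ n)))\<^sup>2
    = dyadic_interp n (geom a b) \<nu>"
proof -
  define m where "m = \<lfloor>2 ^ n * \<nu>\<rfloor>"
  define u where "u = frac (2 ^ n * \<nu>)"
  define p where "p = geom a b (of_int m / 2 ^ n)"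
  define q where "q = geom a b ((of_int m + 1) / 2 ^ n)"
  define c where "c = geom a b ((2 * of_int m + 1) / 2 ^ Suc n)"
  have "sqrt p * sqrt q = c"
    using geom_midpoint[OF assms(1,2), of "of_int m / 2 ^ n" "(of_int m + 1) / 2 ^ n"]
    by (simp add: p_def q_def c_def mult.commute flip: add_divide_distrib)
  then have square: "(sqrt p - sqrt q)\<^sup>2 = p + q - 2 * c"
    using assms by (simp add: power2_diff p_def q_def less_imp_le)
  have coarse: "dyadic_interp n (geom a b) \<nu> = (1 - u) * p + u * q"
    by (simp add: dyadic_interp_def u_def m_def p_def q_def)
  have fine: "dyadic_interp (Suc n) (geom a b) \<nu>
      = (if u < 1 / 2 then (1 - 2 * u) * p + 2 * u * c else (2 - 2 * u) * c + (2 * u - 1) * q)"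
  proof (cases "u < 1 / 2")
    case True
    then have "\<lfloor>2 ^ Suc n * \<nu>\<rfloor> = 2 * m"
      using floor_frac_double(1) by (simp add: u_def m_def mult.assoc)
    moreover from this have "frac (2 ^ Suc n * \<nu>) = 2 * u"
      by (simp add: frac_def u_def m_def)
    ultimately show ?thesis
      using True by (simp add: dyadic_interp_def p_def c_def)
  next
    case False
    then have "\<lfloor>2 ^ Suc n * \<nu>\<rfloor> = 2 * m + 1"
      using floor_frac_double(2) by (simp add: u_def m_def mult.assoc)
    moreover from this have "frac (2 ^ Suc n * \<nu>) = 2 * u - 1"
      by (simp add: frac_def u_def m_def)
    moreover have "(2 * of_int m + 1 + 1) / 2 ^ Suc n = (of_int m + 1) / (2 :: real) ^ n"
      by (simp add: field_simps)
    ultimately show ?thesis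
      using False by (simp add: dyadic_interp_def q_def c_def)
  qed
  show ?thesis
    unfolding fine coarse s_coeff_Suc m_def[symmetric] u_def[symmetric] p_def[symmetric] q_def[symmetric] square
    by (cases "u < 1 / 2") (simp_all add: min_def algebra_simps)
qed

lemma dyadic_interp_add_S_sum:
  assumes "a > 0" "b > 0"
  shows "dyadic_interp N (geom a b) \<nu> + S_sum N \<nu> a b = dyadic_interp 0 (geom a b) \<nu>"
proof (induction N)
  case 0
  show ?case
    by (simp add: S_sum_def)
next
  case (Suc n)
  define m where "m = \<lfloor>2 ^ n * \<nu>\<rfloor>"
  have "S_sum (Suc n) \<nu> a b = S_sum n \<nu> a b + s_coeff (Suc n) \<nu> *
      (sqrt (geom a b (of_int m / 2 ^ n)) - sqrt (geom a b ((of_int m + 1) / 2 ^ n)))\<^sup>2"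
    using root_powi_eq_sqrt_geom[OF assms, of n m] root_powi_eq_sqrt_geom[OF assms, of n "m + 1"]
    by (simp add: S_sum_def k_coeff_def m_def mult.commute diff_diff_eq)
  then show ?case
    using dyadic_interp_step[OF assms, of n \<nu>] Suc.IH by (simp add: m_def)
qed

lemma dyadic_interp_0:
  assumes "0 \<le> \<nu>" "\<nu> \<le> 1" "a > 0" "b > 0"
  shows "dyadic_interp 0 (geom a b) \<nu> = \<nu> * a + (1 - \<nu>) * b"
\<comment> \<open>At \<nu> = 1 the cell is [1, 2] instead of [0, 1], with all the weight on its left
  node.\<close>
proof (cases "\<nu> = 1")
  case True
  then show ?thesis
    using assms by (simp add: dyadic_interp_def geom_def)
next
  case False
  then have "\<lfloor>\<nu>\<rfloor> = 0"
    using assms by linarith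
  then show ?thesis
    using assms by (simp add: dyadic_interp_def geom_def frac_def)
qed

text \<open>The refined Young inequality is applied to the values at the two grid nodes around
  \<nu>. Their ratio is the same in every cell because consecutive nodes are
  \<open>1 / 2 ^ N\<close> apart.\<close>

lemma kantorovich_le_dyadic_interp:
  assumes "a > 0" "b > 0"
  shows "kantorovich (root (2 ^ N) (b / a)) powr beta N \<nu> * geom a b \<nu>
    \<le> dyadic_interp N (geom a b) \<nu>"
proof -
  define m where "m = \<lfloor>2 ^ N * \<nu>\<rfloor>"
  define s t where "s = of_int m / (2 :: real) ^ N" and "t = (of_int m + 1) / (2 :: real) ^ N"
  \<comment> \<open>\<open>alpha\<close> is the interpolation weight of the left node, so
    \<open>beta\<close> is the smaller of the two weights.\<close>
  define u where "u = alpha N \<nu>"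
  have u: "u = 1 - frac (2 ^ N * \<nu>)"
    by (simp add: u_def alpha_def frac_def)
  then have bounds: "0 \<le> u" "u \<le> 1"
    using frac_lt_1[of "2 ^ N * \<nu>"] by (simp_all add: less_imp_le)
  have ratio: "geom a b s / geom a b t = root (2 ^ N) (b / a)"
  proof -
    have "t - s = 1 / 2 ^ N"
      by (simp add: s_def t_def diff_divide_distrib[symmetric])
    then show ?thesis
      using assms by (simp add: geom_divide root_powr_inverse)
  qed
  have mean: "u * s + (1 - u) * t = \<nu>"
    by (simp add: u frac_def s_def t_def m_def field_simps)
  have "kantorovich (geom a b s / geom a b t) powr min u (1 - u)
      * (geom a b s powr u * geom a b t powr (1 - u)) \<le> u * geom a b s + (1 - u) * geom a b t"
    using assms bounds by (intro kantorovich_young) auto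
  then show ?thesis
    unfolding ratio geom_powr_mult[OF assms] mean
    by (simp add: beta_def dyadic_interp_def u s_def t_def m_def flip: u_def)
qed

theorem theorem2p10:
  fixes a b \<nu> :: real and N :: nat
  assumes "a > 0" and "b > 0" and "0 \<le> \<nu>" and "\<nu> \<le> 1" and "N \<ge> 1"
  shows "kantorovich (root (2 ^ N) (b / a)) powr beta N \<nu> * (a powr \<nu> * b powr (1 - \<nu>))
           + S_sum N \<nu> a b \<le> \<nu> * a + (1 - \<nu>) * b"
  using kantorovich_le_dyadic_interp[OF assms(1,2), of N \<nu>]
    dyadic_interp_add_S_sum[OF assms(1,2), of N \<nu>] dyadic_interp_0[OF assms(3,4,1,2)]
  by (simp add: geom_def)

end
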